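(* Let $R$ be an associative ring with identity. Then the following implications hold: if $R$ is reduced, then $R$ is symmetric; if $R$ is symmetric, then $R$ is reversible; if $R$ is reversible, then $R$ is semicommutative; and if $R$ is semicommutative, then $R$ is abelian.
   Context: Rings are associative with identity $1$, not necessarily commutative. A ring $R$ is called: reduced if it has no nonzero nilpotent elements; symmetric if for all $a,b,c\in R$, $abc=0$ implies $acb=0$; reversible if for all $a,b\in R$, $ab=0$ implies $ba=0$; semicommutative if for all $a,b\in R$, $ab=0$ implies $aRb=0$ (that is, $arb=0$ for all $r\in R$); abelian if every idempotent of $R$ is central. *)

theory Defs
  imports "HOL-Algebra.Ring"
begin

(* The locale ring of HOL-Algebra is associative and unital, not necessarily
   commutative, and admits the zero ring. *)

definition nilpotent_elt :: "('a, 'b) ring_scheme \<Rightarrow> 'a \<Rightarrow> bool" where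
  "nilpotent_elt R x \<longleftrightarrow> x \<in> carrier R \<and> (\<exists>n::nat. n > 0 \<and> x [^]\<^bsub>R\<^esub> n = \<zero>\<^bsub>R\<^esub>)"

definition idempotent_elt :: "('a, 'b) ring_scheme \<Rightarrow> 'a \<Rightarrow> bool" where
  "idempotent_elt R e \<longleftrightarrow> e \<in> carrier R \<and> e \<otimes>\<^bsub>R\<^esub> e = e"

definition central_elt :: "('a, 'b) ring_scheme \<Rightarrow> 'a \<Rightarrow> bool" where
  "central_elt R z \<longleftrightarrow> z \<in> carrier R \<and> (\<forall>r \<in> carrier R. z \<otimes>\<^bsub>R\<^esub> r = r \<otimes>\<^bsub>R\<^esub> z)"

definition reduced_ring :: "('a, 'b) ring_scheme \<Rightarrow> bool" where
  "reduced_ring R \<longleftrightarrow> ring R \<and> (\<forall>x. nilpotent_elt R x \<longrightarrow> x = \<zero>\<^bsub>R\<^esub>)"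

definition symmetric_ring :: "('a, 'b) ring_scheme \<Rightarrow> bool" where
  "symmetric_ring R \<longleftrightarrow> ring R \<and>
     (\<forall>a \<in> carrier R. \<forall>b \<in> carrier R. \<forall>c \<in> carrier R.
        a \<otimes>\<^bsub>R\<^esub> b \<otimes>\<^bsub>R\<^esub> c = \<zero>\<^bsub>R\<^esub> \<longrightarrow> a \<otimes>\<^bsub>R\<^esub> c \<otimes>\<^bsub>R\<^esub> b = \<zero>\<^bsub>R\<^esub>)"

definition reversible_ring :: "('a, 'b) ring_scheme \<Rightarrow> bool" where
  "reversible_ring R \<longleftrightarrow> ring R \<and>
     (\<forall>a \<in> carrier R. \<forall>b \<in> carrier R.
        a \<otimes>\<^bsub>R\<^esub> b = \<zero>\<^bsub>R\<^esub> \<longrightarrow> b \<otimes>\<^bsub>R\<^esub> a = \<zero>\<^bsub>R\<^esub>)"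

definition semicommutative_ring :: "('a, 'b) ring_scheme \<Rightarrow> bool" where
  "semicommutative_ring R \<longleftrightarrow> ring R \<and>
     (\<forall>a \<in> carrier R. \<forall>b \<in> carrier R.
        a \<otimes>\<^bsub>R\<^esub> b = \<zero>\<^bsub>R\<^esub> \<longrightarrow> (\<forall>r \<in> carrier R. a \<otimes>\<^bsub>R\<^esub> r \<otimes>\<^bsub>R\<^esub> b = \<zero>\<^bsub>R\<^esub>))"

(* "abelian" refers to idempotents, not to commutativity of multiplication;
   unrelated to the locale abelian_group. *)
definition abelian_ring :: "('a, 'b) ring_scheme \<Rightarrow> bool" where
  "abelian_ring R \<longleftrightarrow> ring R \<and> (\<forall>e. idempotent_elt R e \<longrightarrow> central_elt R e)"

end

theory Submission
  imports Defs "HOL-Algebra.Multiplicative_Group"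
begin

text \<open>
  In a semicommutative ring arbitrary elements may be inserted into a vanishing product. A reduced
  ring is semicommutative: if \<open>ab = 0\<close> then \<open>(ba)\<^sup>2 = b(ab)a = 0\<close>, so it is reversible, and
  reversibility moves a factor of a vanishing product from one end to the other, which is enough
  to insert elements in the middle. If \<open>abc = 0\<close>, two insertions then turn this
  product into \<open>acbac = 0\<close>, hence \<open>(acb)\<^sup>2 = 0\<close> and \<open>acb = 0\<close>; so reduced rings are symmetric.

  Symmetric rings are reversible by putting the factor \<open>1\<close> in front. Finally, an idempotent \<open>e\<close>
  satisfies \<open>e(1 - e) = 0 = (1 - e)e\<close>, and inserting \<open>r\<close> in both products gives \<open>er = ere = re\<close>.
\<close>

lemma (in ring) reduced_square_zero:
  assumes "reduced_ring R" "x \<in> carrier R" "x \<otimes> x = \<zero>"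
  shows "x = \<zero>"
proof -
  have "x [^] (2::nat) = \<zero>"
    using assms by (simp add: numeral_2_eq_2)
  then have "nilpotent_elt R x"
    using assms(2) unfolding nilpotent_elt_def by (intro conjI exI[of _ "2::nat"]) auto
  then show ?thesis
    using assms(1) by (simp add: reduced_ring_def)
qed

lemma (in ring) reduced_imp_reversible:
  assumes "reduced_ring R"
  shows "reversible_ring R"
  unfolding reversible_ring_def
proof (intro conjI ballI impI)
  fix a b assume c: "a \<in> carrier R" "b \<in> carrier R" and ab: "a \<otimes> b = \<zero>"
  have "(b \<otimes> a) \<otimes> (b \<otimes> a) = b \<otimes> (a \<otimes> b) \<otimes> a"
    using c by (simp add: m_assoc)
  also have "\<dots> = \<zero>"
    using c by (simp add: ab)
  finally show "b \<otimes> a = \<zero>"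
    using reduced_square_zero[OF assms, of "b \<otimes> a"] c by simp
qed (rule ring_axioms)

text \<open>
  From \<open>ab = 0\<close> one gets \<open>ba = 0\<close>, hence \<open>b(ar) = 0\<close>; reversing this product puts \<open>r\<close> between
  \<open>a\<close> and \<open>b\<close>.
\<close>

lemma (in ring) reversible_imp_semicommutative:
  assumes "reversible_ring R"
  shows "semicommutative_ring R"
  unfolding semicommutative_ring_def
proof (intro conjI ballI impI)
  fix a b r
  assume c: "a \<in> carrier R" "b \<in> carrier R" "r \<in> carrier R" and ab: "a \<otimes> b = \<zero>"
  have "b \<otimes> a = \<zero>"
    using assms c ab unfolding reversible_ring_def by blast
  then have "b \<otimes> (a \<otimes> r) = \<zero>"
    using c by (simp flip: m_assoc)
  then show "a \<otimes> r \<otimes> b = \<zero>"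
    using assms c m_closed unfolding reversible_ring_def by blast
qed (rule ring_axioms)

lemma (in ring) reduced_imp_symmetric:
  assumes "reduced_ring R"
  shows "symmetric_ring R"
  unfolding symmetric_ring_def
proof (intro conjI ballI impI)
  fix a b c
  assume c: "a \<in> carrier R" "b \<in> carrier R" "c \<in> carrier R" and abc: "a \<otimes> b \<otimes> c = \<zero>"
  have insert: "x \<otimes> r \<otimes> y = \<zero>"
    if "x \<otimes> y = \<zero>" "x \<in> carrier R" "y \<in> carrier R" "r \<in> carrier R" for x y r
    using reversible_imp_semicommutative[OF reduced_imp_reversible[OF assms]] that
    unfolding semicommutative_ring_def by blast
  have "(a \<otimes> b) \<otimes> a \<otimes> c = \<zero>"
    by (rule insert[OF abc]) (use c in simp_all)
  then have "a \<otimes> (b \<otimes> a \<otimes> c) = \<zero>"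
    using c by (simp add: m_assoc)
  then have "a \<otimes> c \<otimes> (b \<otimes> a \<otimes> c) = \<zero>"
    by (rule insert) (use c in simp_all)
  then have "a \<otimes> c \<otimes> (b \<otimes> a \<otimes> c) \<otimes> b = \<zero>"
    using c by simp
  then have "(a \<otimes> c \<otimes> b) \<otimes> (a \<otimes> c \<otimes> b) = \<zero>"
    using c by (simp add: m_assoc)
  then show "a \<otimes> c \<otimes> b = \<zero>"
    using reduced_square_zero[OF assms, of "a \<otimes> c \<otimes> b"] c by simp
qed (rule ring_axioms)

lemma (in ring) symmetric_imp_reversible:
  assumes "symmetric_ring R"
  shows "reversible_ring R"
  unfolding reversible_ring_def
proof (intro conjI ballI impI)
  fix a b assume c: "a \<in> carrier R" "b \<in> carrier R" and ab: "a \<otimes> b = \<zero>"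
  have "\<one> \<otimes> a \<otimes> b = \<zero>"
    using c ab by simp
  then have "\<one> \<otimes> b \<otimes> a = \<zero>"
    using assms c one_closed unfolding symmetric_ring_def by blast
  then show "b \<otimes> a = \<zero>"
    using c by simp
qed (rule ring_axioms)

lemma (in ring) semicommutative_imp_abelian:
  assumes "semicommutative_ring R"
  shows "abelian_ring R"
  unfolding abelian_ring_def central_elt_def
proof (intro conjI allI impI ballI)
  fix e assume "idempotent_elt R e"
  then have e: "e \<in> carrier R" and ee: "e \<otimes> e = e"
    by (simp_all add: idempotent_elt_def)
  show "e \<in> carrier R" by (rule e)
  fix r assume r: "r \<in> carrier R"
  have insert: "x \<otimes> r \<otimes> y = \<zero>"
    if "x \<otimes> y = \<zero>" "x \<in> carrier R" "y \<in> carrier R" for x y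
    using assms that r unfolding semicommutative_ring_def by blast
  have "e \<otimes> (\<one> \<ominus> e) = \<zero>"
    using e by (simp add: minus_eq r_distr r_minus ee r_neg)
  then have "e \<otimes> r \<otimes> (\<one> \<ominus> e) = \<zero>"
    by (rule insert) (use e in simp_all)
  then have "e \<otimes> r \<ominus> e \<otimes> r \<otimes> e = \<zero>"
    using e r by (simp add: minus_eq r_distr r_minus)
  then have left: "e \<otimes> r = e \<otimes> r \<otimes> e"
    using e r by simp
  have "(\<one> \<ominus> e) \<otimes> e = \<zero>"
    using e by (simp add: minus_eq l_distr l_minus ee r_neg)
  then have "(\<one> \<ominus> e) \<otimes> r \<otimes> e = \<zero>"
    by (rule insert) (use e in simp_all)
  then have "r \<otimes> e \<ominus> e \<otimes> r \<otimes> e = \<zero>"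
    using e r by (simp add: minus_eq l_distr l_minus)
  then have "r \<otimes> e = e \<otimes> r \<otimes> e"
    using e r by simp
  with left show "e \<otimes> r = r \<otimes> e"
    by simp
qed (rule ring_axioms)

theorem theorem1:
  fixes R :: "('a, 'b) ring_scheme"
  assumes "ring R"
  shows "(reduced_ring R \<longrightarrow> symmetric_ring R) \<and>
         (symmetric_ring R \<longrightarrow> reversible_ring R) \<and>
         (reversible_ring R \<longrightarrow> semicommutative_ring R) \<and>
         (semicommutative_ring R \<longrightarrow> abelian_ring R)"
  using ring.reduced_imp_symmetric[OF assms] ring.symmetric_imp_reversible[OF assms]
    ring.reversible_imp_semicommutative[OF assms] ring.semicommutative_imp_abelian[OF assms]
  by blast

end
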